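(* Consider a country with two political parties, a finite set of voters $H$, and two elections, Presidential and Parliamentary, each decided by most votes with ties decided by a coin toss. Each voter $h\in H$ has a fixed preferred party $t(h)$ (the same for both elections) and a fixed probability $p_h\in[0,1]$ of voting on any given poll date. Let $P_{\mathrm{sim}}$ be the probability of a sweep when both elections are held on a single common poll date, and let $P_{\mathrm{sep}}$ be the probability of a sweep when the two elections are held on two separate poll dates, where a sweep is the event that one and the same party wins both the presidency and a parliamentary majority. Then $$P_{\mathrm{sim}}\ \ge\ P_{\mathrm{sep}}.$$
   Context: Turnout: on each poll date, each voter $h$ turns out with probability $p_h$, independently across voters and across different poll dates. A voter who turns out on a poll date casts a vote for party $t(h)$ in every election held on that date; a voter who does not turn out casts no vote in the elections of that date. So with a common poll date the set of voters in the two elections is the same random set $S\subseteq H$ (containing each $h$ independently with probability $p_h$), while with separate poll dates the sets of voters $S_1,S_2\subseteq H$ in the two elections are independent, each distributed like $S$. Election outcomes: the Presidential election is won by the party receiving more votes. For the Parliamentary election the set $H$ is partitioned into finitely many (at least one) electoral districts, each having one seat; a district's seat is won by the party receiving more votes among the district's voters who turned out; a party wins a parliamentary majority if it wins strictly more than half of the seats. Every tie in vote count (in the Presidential election or in a district) is decided by a fair coin toss; all these coin tosses are mutually independent and independent of the turnout. *)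

theory Defs
  imports "HOL-Probability.Probability"
begin

datatype party = Party_A | Party_B

definition turnout_pmf :: "'h set \<Rightarrow> ('h \<Rightarrow> real) \<Rightarrow> 'h set pmf" where
  "turnout_pmf H p =
     map_pmf (\<lambda>v. {h \<in> H. v h}) (Pi_pmf H False (\<lambda>h. bernoulli_pmf (p h)))"

definition coin_pmf :: "party pmf" where
  "coin_pmf = pmf_of_set {Party_A, Party_B}"

text \<open>One coin for the Presidential election and one for each district. The default value
  \<open>Party_A\<close> is only taken outside the set \<open>D\<close> of districts and is never looked at.\<close>

definition coins_pmf :: "'d set \<Rightarrow> (party \<times> ('d \<Rightarrow> party)) pmf" where
  "coins_pmf D = pair_pmf coin_pmf (Pi_pmf D Party_A (\<lambda>_. coin_pmf))"

definition votes :: "('h \<Rightarrow> party) \<Rightarrow> 'h set \<Rightarrow> party \<Rightarrow> nat" where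
  "votes t S q = card {h \<in> S. t h = q}"

text \<open>The coin \<open>c\<close> is consulted only in case of a tie, so drawing it in advance is the same
  as tossing it when a tie occurs.\<close>

definition vote_winner :: "('h \<Rightarrow> party) \<Rightarrow> 'h set \<Rightarrow> party \<Rightarrow> party" where
  "vote_winner t S c =
     (if votes t S Party_A > votes t S Party_B then Party_A
      else if votes t S Party_B > votes t S Party_A then Party_B
      else c)"

definition seats ::
  "'d set \<Rightarrow> ('d \<Rightarrow> 'h set) \<Rightarrow> ('h \<Rightarrow> party) \<Rightarrow> 'h set \<Rightarrow> ('d \<Rightarrow> party) \<Rightarrow> party \<Rightarrow> nat" where
  "seats D district t S cs q = card {d \<in> D. vote_winner t (S \<inter> district d) (cs d) = q}"

definition wins_majority ::
  "'d set \<Rightarrow> ('d \<Rightarrow> 'h set) \<Rightarrow> ('h \<Rightarrow> party) \<Rightarrow> 'h set \<Rightarrow> ('d \<Rightarrow> party) \<Rightarrow> party \<Rightarrow> bool" where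
  "wins_majority D district t S cs q \<longleftrightarrow> 2 * seats D district t S cs q > card D"

text \<open>\<open>S1\<close> and \<open>S2\<close> are the sets of voters in the Presidential and in the Parliamentary
  election.\<close>

definition sweep ::
  "'d set \<Rightarrow> ('d \<Rightarrow> 'h set) \<Rightarrow> ('h \<Rightarrow> party) \<Rightarrow> 'h set \<Rightarrow> 'h set \<Rightarrow> party \<Rightarrow> ('d \<Rightarrow> party) \<Rightarrow> bool"
  where
  "sweep D district t S1 S2 c cs \<longleftrightarrow>
     (\<exists>q. vote_winner t S1 c = q \<and> wins_majority D district t S2 cs q)"

definition P_sim ::
  "'h set \<Rightarrow> 'd set \<Rightarrow> ('d \<Rightarrow> 'h set) \<Rightarrow> ('h \<Rightarrow> party) \<Rightarrow> ('h \<Rightarrow> real) \<Rightarrow> real" where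
  "P_sim H D district t p =
     measure_pmf.prob (pair_pmf (turnout_pmf H p) (coins_pmf D))
       {(S, c, cs). sweep D district t S S c cs}"

definition P_sep ::
  "'h set \<Rightarrow> 'd set \<Rightarrow> ('d \<Rightarrow> 'h set) \<Rightarrow> ('h \<Rightarrow> party) \<Rightarrow> ('h \<Rightarrow> real) \<Rightarrow> real" where
  "P_sep H D district t p =
     measure_pmf.prob
       (pair_pmf (pair_pmf (turnout_pmf H p) (turnout_pmf H p)) (coins_pmf D))
       {((S1, S2), c, cs). sweep D district t S1 S2 c cs}"

end

theory Submission imports Defs begin

text \<open>
  The argument rests on positive correlation. Fix a party \<open>q\<close> and the outcomes of all coin tosses.
  Order the turnout sets by how favourable they are to \<open>q\<close>: more supporters of \<open>q\<close> and fewer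
  opponents turning out is better. Both \<^emph>\<open>\<open>q\<close> wins the presidency\<close> and \<^emph>\<open>\<open>q\<close> wins a majority\<close>
  are increasing events for this order, since ties are already resolved by the fixed coins.
  As voters decide independently, Harris' inequality (\<open>Pi_pmf_Harris\<close>) says that the two events are
  nonnegatively correlated: seeing both on one turnout set is at least as likely as
  seeing them on two independent turnout sets. A sweep is the disjoint union of these joint events
  over the two parties, so summing over \<open>q\<close> and averaging over the coins gives the theorem.
  With an even number of districts it can happen that neither party has a majority, so the summand
  of one party does not determine the other, and Harris' inequality is applied to each party.

  Harris' inequality itself is proved for increasing functions with respect to an arbitrary total
  relation in each coordinate. This lets the order run upwards for supporters and downwards for
  opponents of \<open>q\<close>. One coordinate is Chebyshev's association inequality; further coordinates follow
  by conditioning on one of them.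
\<close>

section \<open>Expectations under product distributions\<close>

lemma integrable_measure_pmf_bounded:
  fixes f :: "'a \<Rightarrow> real"
  assumes "\<And>x. \<bar>f x\<bar> \<le> B"
  shows "integrable (measure_pmf M) f"
  using assms by (intro measure_pmf.integrable_const_bound[where B = B]) auto

lemma prob_Collect_eq_expectation:
  "measure_pmf.prob M {x. P x} = measure_pmf.expectation M (\<lambda>x. of_bool (P x))"
proof -
  have "(\<lambda>x. of_bool (P x) :: real) = indicator {x. P x}"
    by (auto simp: indicator_def)
  then show ?thesis by simp
qed

lemma abs_expectation_le:
  fixes f :: "'a \<Rightarrow> real"
  assumes "\<And>x. \<bar>f x\<bar> \<le> B"
  shows "\<bar>measure_pmf.expectation M f\<bar> \<le> B"
proof -
  have "\<bar>measure_pmf.expectation M f\<bar> \<le> measure_pmf.expectation M (\<lambda>x. \<bar>f x\<bar>)"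
    by (rule integral_abs_bound)
  also have "\<dots> \<le> measure_pmf.expectation M (\<lambda>_. B)"
    using assms order_trans[OF abs_ge_zero assms]
    by (intro integral_mono integrable_measure_pmf_bounded[where B = B]) auto
  finally show ?thesis by simp
qed

lemma expectation_pair_pmf_bounded:
  fixes f :: "'a \<times> 'b \<Rightarrow> real"
  assumes "\<And>z. \<bar>f z\<bar> \<le> B"
  shows "measure_pmf.expectation (pair_pmf M N) f =
    measure_pmf.expectation M (\<lambda>x. measure_pmf.expectation N (\<lambda>y. f (x, y)))"
proof -
  have "measure_pmf.expectation (pair_pmf M N) f =
    measure_pmf.expectation (bind_pmf M (\<lambda>x. map_pmf (Pair x) N)) f"
    by (simp add: pair_pmf_def map_pmf_def)
  also have "\<dots> = measure_pmf.expectation M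
      (\<lambda>x. measure_pmf.expectation (map_pmf (Pair x) N) f)"
    unfolding measure_pmf_bind
    by (rule integral_bind[where K = "count_space UNIV" and B = B and B' = 1])
      (use assms measurable_measure_pmf[of "\<lambda>x. map_pmf (Pair x) N"] in auto)
  finally show ?thesis by simp
qed

lemma expectation_pair_pmf_bounded_swap:
  fixes f :: "'a \<times> 'b \<Rightarrow> real"
  assumes "\<And>z. \<bar>f z\<bar> \<le> B"
  shows "measure_pmf.expectation (pair_pmf M N) f =
    measure_pmf.expectation N (\<lambda>y. measure_pmf.expectation M (\<lambda>x. f (x, y)))"
  using assms
  by (subst pair_commute_pmf)
     (simp add: case_prod_beta' expectation_pair_pmf_bounded[where B = B])

section \<open>Harris' inequality\<close>

text \<open>
  By totality and monotonicity, \<open>f x - f y\<close> and \<open>g x - g y\<close> agree in sign, so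
  \<open>(f x - f y) * (g x - g y)\<close> is nonnegative. Averaging it over independent \<open>x\<close> and \<open>y\<close> gives twice
  the covariance.
\<close>
lemma Chebyshev_association:
  fixes f g :: "'a \<Rightarrow> real"
  assumes total: "\<And>x y. le x y \<or> le y x"
    and f_mono: "\<And>x y. le x y \<Longrightarrow> f x \<le> f y" and g_mono: "\<And>x y. le x y \<Longrightarrow> g x \<le> g y"
    and f_bound: "\<And>x. \<bar>f x\<bar> \<le> B" and g_bound: "\<And>x. \<bar>g x\<bar> \<le> C"
  shows "measure_pmf.expectation M f * measure_pmf.expectation M g
    \<le> measure_pmf.expectation M (\<lambda>x. f x * g x)"
proof -
  let ?E = "measure_pmf.expectation M"
  have fg_bound: "\<bar>f x * g x\<bar> \<le> B * C" for x
    unfolding abs_mult using f_bound g_bound order_trans[OF abs_ge_zero f_bound]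
    by (intro mult_mono) auto
  note [simp] = integrable_measure_pmf_bounded[of f, OF f_bound]
    integrable_measure_pmf_bounded[of g, OF g_bound]
    integrable_measure_pmf_bounded[of "\<lambda>x. f x * g x", OF fg_bound]
  have inner: "0 \<le> f x * g x - f x * ?E g - ?E f * g x + ?E (\<lambda>y. f y * g y)" for x
  proof -
    have nonneg: "0 \<le> (f x - f y) * (g x - g y)" for y
      using total[of x y] f_mono g_mono
      by (metis diff_ge_0_iff_ge diff_le_0_iff_le mult_nonneg_nonneg mult_nonpos_nonpos)
    have "0 \<le> ?E (\<lambda>y. (f x - f y) * (g x - g y))"
      by (intro integral_nonneg_AE) (simp add: nonneg)
    also have "(\<lambda>y. (f x - f y) * (g x - g y))
        = (\<lambda>y. f x * g x - f x * g y - f y * g x + f y * g y)"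
      by (simp add: algebra_simps)
    also have "?E \<dots> = f x * g x - f x * ?E g - ?E f * g x + ?E (\<lambda>y. f y * g y)"
      by simp
    finally show ?thesis .
  qed
  have "0 \<le> ?E (\<lambda>x. f x * g x - f x * ?E g - ?E f * g x + ?E (\<lambda>y. f y * g y))"
    by (intro integral_nonneg_AE) (simp add: inner)
  also have "\<dots> = 2 * ?E (\<lambda>x. f x * g x) - 2 * (?E f * ?E g)"
    by simp
  finally show ?thesis by simp
qed

text \<open>
  The induction singles out one coordinate \<open>i\<close>. For each of its values, the induction hypothesis
  applies to the remaining coordinates. The resulting conditional expectations are again
  monotone in the value of \<open>i\<close>, so the one-coordinate inequality finishes the step.
\<close>
theorem Pi_pmf_Harris:
  fixes f g :: "('i \<Rightarrow> 'a) \<Rightarrow> real" and le :: "'i \<Rightarrow> 'a \<Rightarrow> 'a \<Rightarrow> bool"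
  assumes "finite I"
    and total: "\<And>i x y. le i x y \<or> le i y x"
    and "\<And>v w. (\<And>i. le i (v i) (w i)) \<Longrightarrow> f v \<le> f w"
    and "\<And>v w. (\<And>i. le i (v i) (w i)) \<Longrightarrow> g v \<le> g w"
    and "\<And>v. \<bar>f v\<bar> \<le> B" and "\<And>v. \<bar>g v\<bar> \<le> C"
  shows "measure_pmf.expectation (Pi_pmf I d p) f * measure_pmf.expectation (Pi_pmf I d p) g
    \<le> measure_pmf.expectation (Pi_pmf I d p) (\<lambda>v. f v * g v)"
  using assms(1,3-)
proof (induction I arbitrary: f g rule: finite_induct)
  case empty
  show ?case by simp
next
  case (insert i I)
  note f_mono = insert.prems(1) and g_mono = insert.prems(2)
    and f_bound = insert.prems(3) and g_bound = insert.prems(4)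
  let ?E = "measure_pmf.expectation (Pi_pmf I d p)"
  let ?Ei = "measure_pmf.expectation (p i)"
  have refl: "le j x x" for j x
    using total by blast
  have fg_bound: "\<bar>f v * g v\<bar> \<le> B * C" for v
    unfolding abs_mult using f_bound g_bound order_trans[OF abs_ge_zero f_bound]
    by (intro mult_mono) auto
  have split: "measure_pmf.expectation (Pi_pmf (insert i I) d p) h
      = ?Ei (\<lambda>x. ?E (\<lambda>v. h (v(i := x))))" if "\<And>v. \<bar>h v\<bar> \<le> b" for h :: "_ \<Rightarrow> real" and b
    using that insert.hyps
    by (simp add: Pi_pmf_insert case_prod_beta' expectation_pair_pmf_bounded[where B = b])
  have cond_mono: "?E (\<lambda>v. h (v(i := x))) \<le> ?E (\<lambda>v. h (v(i := y)))"
    if "le i x y" "\<And>v w. (\<And>j. le j (v j) (w j)) \<Longrightarrow> h v \<le> h w" "\<And>v. \<bar>h v\<bar> \<le> b"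
    for h :: "_ \<Rightarrow> real" and b x y
    using that refl
    by (intro integral_mono integrable_measure_pmf_bounded[where B = b] that) auto
  have cond: "?E (\<lambda>v. f (v(i := x))) * ?E (\<lambda>v. g (v(i := x)))
      \<le> ?E (\<lambda>v. f (v(i := x)) * g (v(i := x)))" for x
    using f_bound g_bound refl by (intro insert.IH f_mono g_mono) auto
  have "?Ei (\<lambda>x. ?E (\<lambda>v. f (v(i := x)))) * ?Ei (\<lambda>x. ?E (\<lambda>v. g (v(i := x))))
      \<le> ?Ei (\<lambda>x. ?E (\<lambda>v. f (v(i := x))) * ?E (\<lambda>v. g (v(i := x))))"
    by (rule Chebyshev_association[where le = "le i" and B = B and C = C])
      (use total f_mono g_mono f_bound g_bound in
        \<open>auto intro!: abs_expectation_le cond_mono[of _ _ f] cond_mono[of _ _ g]\<close>)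
  also have "\<dots> \<le> ?Ei (\<lambda>x. ?E (\<lambda>v. f (v(i := x)) * g (v(i := x))))"
  proof (rule integral_mono)
    show "integrable (p i) (\<lambda>x. ?E (\<lambda>v. f (v(i := x))) * ?E (\<lambda>v. g (v(i := x))))"
      using order_trans[OF abs_ge_zero f_bound]
      by (intro integrable_measure_pmf_bounded[where B = "B * C"])
        (auto simp: abs_mult intro!: mult_mono abs_expectation_le f_bound g_bound)
    show "integrable (p i) (\<lambda>x. ?E (\<lambda>v. f (v(i := x)) * g (v(i := x))))"
      by (intro integrable_measure_pmf_bounded[where B = "B * C"] abs_expectation_le fg_bound)
  qed (rule cond)
  finally show ?case
    by (simp only: split[OF f_bound] split[OF g_bound] split[OF fg_bound])
qed

section \<open>Elections are monotone in the turnout\<close>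

text \<open>
  The change from \<open>S\<close> to \<open>S'\<close> helps \<open>q\<close>. Comparing sets of voters instead of vote totals makes the
  relation survive restriction to a district.
\<close>
definition favours :: "('h \<Rightarrow> party) \<Rightarrow> party \<Rightarrow> 'h set \<Rightarrow> 'h set \<Rightarrow> bool" where
  "favours t q S S' \<longleftrightarrow>
     {h \<in> S. t h = q} \<subseteq> {h \<in> S'. t h = q} \<and> {h \<in> S'. t h \<noteq> q} \<subseteq> {h \<in> S. t h \<noteq> q}"

lemma favours_Int: "favours t q S S' \<Longrightarrow> favours t q (S \<inter> T) (S' \<inter> T)"
  by (auto simp: favours_def)

lemma vote_winner_favours:
  assumes "favours t q S S'" "finite S" "finite S'" "vote_winner t S c = q"
  shows "vote_winner t S' c = q"
proof -
  have own: "votes t S q \<le> votes t S' q"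
    using assms by (auto simp: favours_def votes_def intro!: card_mono)
  have other: "votes t S' r \<le> votes t S r" if "r \<noteq> q" for r
    using assms that by (auto simp: favours_def votes_def intro!: card_mono)
  show ?thesis
    using own other[of Party_A] other[of Party_B] assms(4)
    by (cases q) (auto simp: vote_winner_def split: if_splits)
qed

lemma wins_majority_favours:
  assumes "favours t q S S'" "finite S" "finite S'" "finite D"
    "wins_majority D district t S cs q"
  shows "wins_majority D district t S' cs q"
proof -
  have "seats D district t S cs q \<le> seats D district t S' cs q"
    unfolding seats_def
    using assms vote_winner_favours[OF favours_Int[OF assms(1)]]
    by (intro card_mono) auto
  then show ?thesis
    using assms(5) by (simp add: wins_majority_def)
qed

text \<open>
  The order on turnout sets is the product, over the voters, of an order on \<^typ>\<open>bool\<close>: turning out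
  is the larger value for supporters of \<open>q\<close> and the smaller one for opponents.
\<close>
lemma turnout_positive_correlation:
  fixes P Q :: "'h set \<Rightarrow> bool"
  assumes "finite H"
    and P_mono: "\<And>S S'. favours t q S S' \<Longrightarrow> finite S \<Longrightarrow> finite S' \<Longrightarrow> P S \<Longrightarrow> P S'"
    and Q_mono: "\<And>S S'. favours t q S S' \<Longrightarrow> finite S \<Longrightarrow> finite S' \<Longrightarrow> Q S \<Longrightarrow> Q S'"
  shows "measure_pmf.expectation (turnout_pmf H p) (\<lambda>S. of_bool (P S))
      * measure_pmf.expectation (turnout_pmf H p) (\<lambda>S. of_bool (Q S))
    \<le> measure_pmf.expectation (turnout_pmf H p) (\<lambda>S. of_bool (P S) * of_bool (Q S) :: real)"
proof -
  define le where "le h x y \<longleftrightarrow> (if t h = q then x \<longrightarrow> y else y \<longrightarrow> x)" for h x y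
  have favours: "favours t q {h \<in> H. v h} {h \<in> H. w h}" if "\<And>h. le h (v h) (w h)" for v w
    using that unfolding favours_def le_def by (smt (verit) Collect_mono_iff mem_Collect_eq)
  have mono: "of_bool (R {h \<in> H. v h}) \<le> (of_bool (R {h \<in> H. w h}) :: real)"
    if "\<And>S S'. favours t q S S' \<Longrightarrow> finite S \<Longrightarrow> finite S' \<Longrightarrow> R S \<Longrightarrow> R S'"
      and "\<And>h. le h (v h) (w h)" for R v w
    using that(1)[OF favours[OF that(2)]] assms(1) by auto
  show ?thesis
    unfolding turnout_pmf_def integral_map_pmf
  proof (rule Pi_pmf_Harris[where le = le and B = 1 and C = 1])
    show "le h x y \<or> le h y x" for h x y
      by (auto simp: le_def)
    show "of_bool (P {h \<in> H. v h}) \<le> (of_bool (P {h \<in> H. w h}) :: real)"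
      if "\<And>h. le h (v h) (w h)" for v w
      using P_mono that by (rule mono)
    show "of_bool (Q {h \<in> H. v h}) \<le> (of_bool (Q {h \<in> H. w h}) :: real)"
      if "\<And>h. le h (v h) (w h)" for v w
      using Q_mono that by (rule mono)
  qed (use assms(1) in auto)
qed

section \<open>The probability of a sweep\<close>

text \<open>At most one summand is nonzero, because the presidency has only one winner.\<close>
lemma of_bool_sweep:
  "of_bool (sweep D district t S1 S2 c cs) =
    of_bool (vote_winner t S1 c = Party_A) * of_bool (wins_majority D district t S2 cs Party_A) +
    (of_bool (vote_winner t S1 c = Party_B) * of_bool (wins_majority D district t S2 cs Party_B)
      :: real)"
  by (cases "vote_winner t S1 c") (auto simp: sweep_def)

text \<open>
  The coins are drawn independently of the turnout. Taking their expectation outermost reduces the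
  comparison to one for each fixed outcome of the coins.
\<close>
lemma P_sim_eq:
  "P_sim H D district t p =
    measure_pmf.expectation (coins_pmf D) (\<lambda>(c, cs).
      measure_pmf.expectation (turnout_pmf H p) (\<lambda>S. of_bool (sweep D district t S S c cs)))"
proof -
  have "P_sim H D district t p = measure_pmf.expectation
      (pair_pmf (turnout_pmf H p) (coins_pmf D))
      (\<lambda>(S, c, cs). of_bool (sweep D district t S S c cs))"
    unfolding P_sim_def
    by (simp add: prob_Collect_eq_expectation case_prod_beta')
  then show ?thesis
    by (subst (asm) expectation_pair_pmf_bounded_swap[where B = 1]) (auto simp: case_prod_beta')
qed

lemma P_sep_eq:
  "P_sep H D district t p =
    measure_pmf.expectation (coins_pmf D) (\<lambda>(c, cs).
      measure_pmf.expectation (turnout_pmf H p) (\<lambda>S1.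
        measure_pmf.expectation (turnout_pmf H p) (\<lambda>S2.
          of_bool (sweep D district t S1 S2 c cs))))"
proof -
  have "P_sep H D district t p = measure_pmf.expectation
      (pair_pmf (pair_pmf (turnout_pmf H p) (turnout_pmf H p)) (coins_pmf D))
      (\<lambda>((S1, S2), c, cs). of_bool (sweep D district t S1 S2 c cs))"
    unfolding P_sep_def
    by (simp add: prob_Collect_eq_expectation case_prod_beta')
  then show ?thesis
    by (subst (asm) expectation_pair_pmf_bounded_swap[where B = 1])
       (auto simp: case_prod_beta' expectation_pair_pmf_bounded[where B = 1])
qed

theorem theoremA:
  fixes H :: "'h set" and D :: "'d set" and district :: "'d \<Rightarrow> 'h set"
    and t :: "'h \<Rightarrow> party" and p :: "'h \<Rightarrow> real"
  assumes "finite H"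
    and "finite D" and "D \<noteq> {}"
    and "disjoint_family_on district D" and "(\<Union>d\<in>D. district d) = H"
    and "\<And>h. h \<in> H \<Longrightarrow> 0 \<le> p h \<and> p h \<le> 1"
  shows "P_sim H D district t p \<ge> P_sep H D district t p"
proof -
  let ?E = "measure_pmf.expectation (turnout_pmf H p)"
  have int: "integrable (turnout_pmf H p) (\<lambda>S. of_bool (P S) :: real)" for P
    by (rule integrable_measure_pmf_bounded[where B = 1]) auto
  have int2: "integrable (turnout_pmf H p) (\<lambda>S. of_bool (P S) * of_bool (Q S) :: real)" for P Q
    by (rule integrable_measure_pmf_bounded[where B = 1]) auto
  have fixed_coins: "?E (\<lambda>S1. ?E (\<lambda>S2. of_bool (sweep D district t S1 S2 c cs) :: real))
      \<le> ?E (\<lambda>S. of_bool (sweep D district t S S c cs))" for c cs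
  proof -
    let ?W = "\<lambda>q S. of_bool (vote_winner t S c = q) :: real"
    let ?M = "\<lambda>q S. of_bool (wins_majority D district t S cs q) :: real"
    have "?E (\<lambda>S1. ?E (\<lambda>S2. of_bool (sweep D district t S1 S2 c cs) :: real))
        = ?E (?W Party_A) * ?E (?M Party_A) + ?E (?W Party_B) * ?E (?M Party_B)"
      by (simp add: of_bool_sweep int)
    also have "\<dots> \<le> ?E (\<lambda>S. ?W Party_A S * ?M Party_A S) + ?E (\<lambda>S. ?W Party_B S * ?M Party_B S)"
      using assms(1,2) vote_winner_favours wins_majority_favours
      by (intro add_mono turnout_positive_correlation) blast+
    also have "\<dots> = ?E (\<lambda>S. of_bool (sweep D district t S S c cs))"
      by (simp add: of_bool_sweep int2)
    finally show ?thesis .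
  qed
  show ?thesis
    unfolding P_sim_eq P_sep_eq
    by (rule integral_mono)
      (auto simp: case_prod_beta' fixed_coins
        intro!: integrable_measure_pmf_bounded[where B = 1] abs_expectation_le)
qed

end
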